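(* Let $H$ and $U$ be Hilbert spaces, let $0<\tau<\infty$, let $(U(t,s))_{t\ge s\ge 0}$ be the evolution family on $H$ associated with a family $(A(t))_{t\ge 0}$ of bounded operators on $H$, and let $B(t)\in\mathcal L(U,H)$, $0\le t\le\tau$, be an admissible family of control operators, i.e. $\Psi_\tau u:=\int_0^\tau U(\tau,s)B(s)u(s)\,ds$ defines a bounded linear operator $\Psi_\tau:L^2(0,\tau;U)\to H$. Then the system $x'(t)+A(t)x(t)=B(t)u(t)$, $x(0)=x_0$, is exactly controllable at time $\tau$ if and only if there exists a constant $C>0$ such that for all $x\in H$ $$\|x\|_H\le C\left(\int_0^\tau\|B(s)^*U(\tau,s)^*x\|_U^2\,ds\right)^{1/2}.$$
   Context: An evolution family is a family of bounded operators $U(t,s)$, $t\ge s\ge 0$, on $H$ with $U(t,t)=I$, $U(t,s)=U(t,r)U(r,s)$ for $t\ge r\ge s\ge 0$, $\|U(t,s)\|\le Me^{\omega(t-s)}$ for some $M,\omega>0$, and $(t,s)\mapsto U(t,s)x$ jointly continuous for every $x\in H$. It is associated with $(A(t))$ in the sense that $t\mapsto U(t,s)x_s$ solves $x'(t)+A(t)x(t)=0$, $x(s)=x_s$. (The letter $U$ alone denotes the control Hilbert space; $U(t,s)$ denotes the evolution family.) For a control $u\in L^2(0,\tau;U)$ the solution of $x'(t)+A(t)x(t)=B(t)u(t)$, $x(0)=x_0$, is defined as $x(t)=U(t,0)x_0+\int_0^tU(t,s)B(s)u(s)\,ds$. The system is exactly controllable at time $\tau$ if for every $x_0,x_1\in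 H$ there exists $u\in L^2(0,\tau;U)$ such that the solution satisfies $x(\tau)=x_1$.
   Formalization: For every x the map s ↦ B(s)*U(τ,s)*x is also assumed to be almost everywhere separably valued (automatic if U is separable); without this the equivalence fails, e.g. for U=ℓ²([0,1]), H=ℝ, U(t,s)=I, τ=1, B(s)v=v_s. *)

theory Defs
  imports "HOL-Analysis.Analysis"
begin

text \<open>
  Hilbert spaces are types of sort \<open>{real_inner, banach}\<close>; a complex Hilbert space is covered through
  its underlying real inner product, which has the same norm and the same adjoints.

  The library's Bochner integral is restricted to second-countable spaces. The integral below is the
  library's one with Borel measurability replaced by strong measurability, so that it applies to
  functions into every normed space.
\<close>

definition strongly_measurable :: "'a measure \<Rightarrow> ('a \<Rightarrow> 'b::real_normed_vector) \<Rightarrow> bool" where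
  "strongly_measurable M f \<longleftrightarrow>
    (\<exists>\<phi>. (\<forall>i::nat. simple_function M (\<phi> i)) \<and> (AE x in M. (\<lambda>i. \<phi> i x) \<longlonglongrightarrow> f x))"

definition has_strong_integral :: "'a measure \<Rightarrow> ('a \<Rightarrow> 'b::real_normed_vector) \<Rightarrow> 'b \<Rightarrow> bool" where
  "has_strong_integral M f y \<longleftrightarrow>
    strongly_measurable M f \<and>
    (\<exists>\<phi>. (\<forall>i::nat. Bochner_Integration.simple_bochner_integrable M (\<phi> i)) \<and>
         (\<lambda>i. \<integral>\<^sup>+x. norm (f x - \<phi> i x) \<partial>M) \<longlonglongrightarrow> 0 \<and>
         (\<lambda>i. Bochner_Integration.simple_bochner_integral M (\<phi> i)) \<longlonglongrightarrow> y)"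

definition strongly_integrable :: "'a measure \<Rightarrow> ('a \<Rightarrow> 'b::real_normed_vector) \<Rightarrow> bool" where
  "strongly_integrable M f \<longleftrightarrow> (\<exists>y. has_strong_integral M f y)"

definition strong_integral :: "'a measure \<Rightarrow> ('a \<Rightarrow> 'b::real_normed_vector) \<Rightarrow> 'b" where
  "strong_integral M f = (THE y. has_strong_integral M f y)"

lemma strongly_measurable_borel:
  fixes f :: "'a \<Rightarrow> 'b::{real_normed_vector, second_countable_topology}"
  assumes "f \<in> borel_measurable M"
  shows "strongly_measurable M f"
proof -
  obtain \<phi> where "\<And>i. simple_function M (\<phi> i)" "\<And>x. x \<in> space M \<Longrightarrow> (\<lambda>i. \<phi> i x) \<longlonglongrightarrow> f x"
    using borel_measurable_implies_sequence_metric[OF assms, of 0] by metis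
  then show ?thesis
    unfolding strongly_measurable_def by (intro exI[of _ \<phi>]) auto
qed

lemma has_bochner_integral_imp_has_strong_integral:
  fixes f :: "'a \<Rightarrow> 'b::{real_normed_vector, second_countable_topology}"
  assumes "has_bochner_integral M f y"
  shows "has_strong_integral M f y"
  using assms
proof (cases rule: has_bochner_integral.cases)
  case (1 \<phi>)
  then show ?thesis
    unfolding has_strong_integral_def using strongly_measurable_borel by blast
qed

text \<open>Elements of \<open>L\<^sup>2(0,\<tau>;U)\<close> are handled through representatives.\<close>

definition L2 :: "real \<Rightarrow> (real \<Rightarrow> 'b::real_normed_vector) set" where
  "L2 \<tau> = {u. strongly_measurable (lebesgue_on {0..\<tau>}) u \<and>
              integrable (lebesgue_on {0..\<tau>}) (\<lambda>s. (norm (u s))\<^sup>2)}"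

definition L2_norm :: "real \<Rightarrow> (real \<Rightarrow> 'b::real_normed_vector) \<Rightarrow> real" where
  "L2_norm \<tau> u = sqrt (LINT s|lebesgue_on {0..\<tau>}. (norm (u s))\<^sup>2)"

text \<open>
  The evolution family \<open>U(t,s)\<close> is written \<open>V t s\<close>; all values outside \<open>t \<ge> s \<ge> 0\<close> are irrelevant.
\<close>

definition evolution_family :: "(real \<Rightarrow> real \<Rightarrow> 'h::real_normed_vector \<Rightarrow>\<^sub>L 'h) \<Rightarrow> bool" where
  "evolution_family V \<longleftrightarrow>
    (\<forall>t\<ge>0. V t t = id_blinfun) \<and>
    (\<forall>t r s. 0 \<le> s \<and> s \<le> r \<and> r \<le> t \<longrightarrow> V t s = V t r o\<^sub>L V r s) \<and>
    (\<exists>M>0. \<exists>\<omega>>0. \<forall>t s. 0 \<le> s \<and> s \<le> t \<longrightarrow> norm (V t s) \<le> M * exp (\<omega> * (t - s))) \<and>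
    (\<forall>x. continuous_on {(t, s). 0 \<le> s \<and> s \<le> t} (\<lambda>(t, s). V t s x))"

definition solves_homogeneous ::
    "(real \<Rightarrow> 'h::real_normed_vector \<Rightarrow>\<^sub>L 'h) \<Rightarrow> real \<Rightarrow> 'h \<Rightarrow> (real \<Rightarrow> 'h) \<Rightarrow> bool" where
  "solves_homogeneous A s xs x \<longleftrightarrow>
    x s = xs \<and>
    (\<forall>t\<ge>s. \<exists>x'. (x has_vector_derivative x') (at t within {s..}) \<and> x' + A t (x t) = 0)"

definition associated_with ::
    "(real \<Rightarrow> real \<Rightarrow> 'h::real_normed_vector \<Rightarrow>\<^sub>L 'h) \<Rightarrow> (real \<Rightarrow> 'h \<Rightarrow>\<^sub>L 'h) \<Rightarrow> bool" where
  "associated_with V A \<longleftrightarrow> (\<forall>s\<ge>0. \<forall>xs. solves_homogeneous A s xs (\<lambda>t. V t s xs))"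

definition input_map ::
    "(real \<Rightarrow> real \<Rightarrow> 'h::real_normed_vector \<Rightarrow>\<^sub>L 'h) \<Rightarrow> (real \<Rightarrow> 'u::real_normed_vector \<Rightarrow>\<^sub>L 'h)
      \<Rightarrow> real \<Rightarrow> (real \<Rightarrow> 'u) \<Rightarrow> 'h" where
  "input_map V B t u = strong_integral (lebesgue_on {0..t}) (\<lambda>s. V t s (B s (u s)))"

text \<open>
  Linearity together with the norm bound makes \<open>input_map V B \<tau>\<close> independent of the representative,
  hence a bounded linear operator on the space of equivalence classes.
\<close>

definition admissible ::
    "real \<Rightarrow> (real \<Rightarrow> real \<Rightarrow> 'h::real_normed_vector \<Rightarrow>\<^sub>L 'h) \<Rightarrow> (real \<Rightarrow> 'u::real_normed_vector \<Rightarrow>\<^sub>L 'h)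
      \<Rightarrow> bool" where
  "admissible \<tau> V B \<longleftrightarrow>
    (\<forall>u\<in>L2 \<tau>. strongly_integrable (lebesgue_on {0..\<tau>}) (\<lambda>s. V \<tau> s (B s (u s)))) \<and>
    (\<forall>u\<in>L2 \<tau>. \<forall>v\<in>L2 \<tau>.
      input_map V B \<tau> (\<lambda>s. u s + v s) = input_map V B \<tau> u + input_map V B \<tau> v) \<and>
    (\<forall>c. \<forall>u\<in>L2 \<tau>. input_map V B \<tau> (\<lambda>s. c *\<^sub>R u s) = c *\<^sub>R input_map V B \<tau> u) \<and>
    (\<exists>K. \<forall>u\<in>L2 \<tau>. norm (input_map V B \<tau> u) \<le> K * L2_norm \<tau> u)"

definition solution ::
    "(real \<Rightarrow> real \<Rightarrow> 'h::real_normed_vector \<Rightarrow>\<^sub>L 'h) \<Rightarrow> (real \<Rightarrow> 'u::real_normed_vector \<Rightarrow>\<^sub>L 'h)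
      \<Rightarrow> 'h \<Rightarrow> (real \<Rightarrow> 'u) \<Rightarrow> real \<Rightarrow> 'h" where
  "solution V B x0 u t = V t 0 x0 + input_map V B t u"

definition exactly_controllable ::
    "real \<Rightarrow> (real \<Rightarrow> real \<Rightarrow> 'h::real_normed_vector \<Rightarrow>\<^sub>L 'h) \<Rightarrow> (real \<Rightarrow> 'u::real_normed_vector \<Rightarrow>\<^sub>L 'h)
      \<Rightarrow> bool" where
  "exactly_controllable \<tau> V B \<longleftrightarrow> (\<forall>x0 x1. \<exists>u\<in>L2 \<tau>. solution V B x0 u \<tau> = x1)"

text \<open>
  Pettis' condition. It holds for every function into a separable space. Some condition of this kind
  is needed for a non-separable control space \<open>U\<close>: for \<open>U = \<ell>\<^sup>2([0,1])\<close>, \<open>H = \<real>\<close>, \<open>V t s = id\<close>,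
  \<open>\<tau> = 1\<close> and \<open>B(s)v = v\<^sub>s\<close> the function \<open>B(s)u(s)\<close> vanishes almost everywhere for each
  \<open>u \<in> L\<^sup>2(0,1;U)\<close>, so the system is not controllable, although \<open>\<parallel>B(s)\<^sup>*x\<parallel> = \<bar>x\<bar>\<close> for every \<open>s\<close>.
\<close>

definition ae_separably_valued :: "'a measure \<Rightarrow> ('a \<Rightarrow> 'b::topological_space) \<Rightarrow> bool" where
  "ae_separably_valued M f \<longleftrightarrow> (\<exists>D. countable D \<and> (AE x in M. f x \<in> closure D))"

lemma ae_separably_valued_second_countable:
  fixes f :: "'a \<Rightarrow> 'b::second_countable_topology"
  shows "ae_separably_valued M f"
proof -
  obtain D :: "'b set" where "countable D" "\<And>X. open X \<Longrightarrow> X \<noteq> {} \<Longrightarrow> \<exists>d\<in>D. d \<in> X"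
    using countable_dense_exists by blast
  then have "closure D = UNIV"
    unfolding set_eq_iff closure_iff_nhds_not_empty by fast
  with \<open>countable D\<close> show ?thesis
    unfolding ae_separably_valued_def by (intro exI[of _ D]) simp
qed

end

theory Submission
  imports Defs
begin

text \<open>
  Let \<open>\<Psi> = input_map V B \<tau>\<close>. The free motion only shifts the target, so exact controllability says that
  \<open>\<Psi>\<close> maps \<open>L\<^sup>2(0,\<tau>;U)\<close> onto \<open>H\<close>. The function \<open>\<Psi>\<^sup>* x = observation V B \<tau> x\<close>, with values
  \<open>B(s)\<^sup>* U(\<tau>,s)\<^sup>* x\<close>, satisfies \<open>\<langle>\<Psi> u, x\<rangle> = \<langle>u, \<Psi>\<^sup>* x\<rangle>\<close> (\<open>input_map_inner\<close>), and the theorem is the duality between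
  surjectivity of an operator and boundedness below of its adjoint.

  This duality makes sense only once \<open>\<Psi>\<^sup>* x\<close> is known to be in \<open>L\<^sup>2\<close>. Admissibility makes it weakly
  measurable, Pettis' theorem strongly measurable (\<open>Pettis_measurability\<close>), and testing \<open>\<Psi>\<close> with truncations
  of \<open>\<Psi>\<^sup>* x\<close> bounds its norm (\<open>observation_in_L2\<close>).

  Both implications take place in \<open>H\<close>, whose completeness drives them, so that \<open>L\<^sup>2\<close> can remain a set of
  representatives. If \<open>\<Psi>\<close> is onto, the set \<open>{x. \<parallel>\<Psi>\<^sup>* x\<parallel> \<le> 1}\<close> is weakly bounded, hence bounded by the uniform
  boundedness principle (\<open>weakly_bounded_imp_bounded\<close>). Conversely, the observability inequality says that
  the Gramian \<open>\<Psi> \<Psi>\<^sup>*\<close> is coercive on \<open>H\<close>, hence onto by the Lax--Milgram theorem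
  (\<open>coercive_bounded_linear_surj\<close>); then \<open>\<Psi>\<close> is onto as well.
\<close>

section \<open>Hilbert spaces: representation, uniform boundedness, coercivity\<close>

text \<open>
  The representing vector is the minimiser of the strictly convex functional
  \<open>\<Phi> x = \<parallel>x\<parallel>\<^sup>2 - 2 f x\<close>. The parallelogram law makes every minimising sequence Cauchy, so completeness
  supplies a minimiser, and the vanishing first variation there reads \<open>f x = x \<bullet> y\<close>.
\<close>

lemma riesz_representation:
  fixes f :: "'a::{real_inner, banach} \<Rightarrow> real"
  assumes "bounded_linear f"
  obtains y where "\<And>x. f x = x \<bullet> y"
proof -
  interpret f: bounded_linear f by fact
  define \<Phi> where "\<Phi> x = (norm x)\<^sup>2 - 2 * f x" for x
  define m where "m = (INF x. \<Phi> x)"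
  have bdd: "bdd_below (range \<Phi>)"
  proof -
    have "- (onorm f)\<^sup>2 \<le> \<Phi> x" for x
    proof -
      have "f x \<le> onorm f * norm x"
        using onorm[OF assms, of x] by simp
      then have "\<Phi> x \<ge> (norm x)\<^sup>2 - 2 * (onorm f * norm x)"
        unfolding \<Phi>_def by linarith
      moreover have "(norm x)\<^sup>2 - 2 * (onorm f * norm x) + (onorm f)\<^sup>2 = (norm x - onorm f)\<^sup>2"
        by (simp add: power2_diff)
      ultimately show ?thesis
        using zero_le_power2[of "norm x - onorm f"] by linarith
    qed
    then show ?thesis by (auto intro!: bdd_belowI)
  qed
  have m_le: "m \<le> \<Phi> x" for x
    unfolding m_def by (rule cINF_lower[OF bdd]) simp
  have "\<exists>x. \<Phi> x < m + inverse (real (Suc n))" for n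
  proof -
    have "(INF x. \<Phi> x) < m + inverse (real (Suc n))"
      unfolding m_def by simp
    then show ?thesis
      by (subst (asm) cINF_less_iff[OF _ bdd]) auto
  qed
  then obtain z where z: "\<And>n. \<Phi> (z n) < m + inverse (real (Suc n))"
    by metis
  \<comment> \<open>parallelogram law: two almost minimisers are close, since their midpoint cannot go below \<open>m\<close>\<close>
  have near: "(norm (a - b))\<^sup>2 \<le> 2 * (\<Phi> a - m) + 2 * (\<Phi> b - m)" for a b
  proof -
    have "\<Phi> ((1/2) *\<^sub>R (a + b)) = (\<Phi> a + \<Phi> b) / 2 - (norm (a - b))\<^sup>2 / 4"
      unfolding \<Phi>_def power2_norm_eq_inner
      by (simp add: f.add f.scaleR algebra_simps inner_commute) (simp add: field_simps)
    then show ?thesis using m_le[of "(1/2) *\<^sub>R (a + b)"] by (simp add: field_simps)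
  qed
  have "Cauchy z"
  proof (rule metric_CauchyI)
    fix e :: real assume "0 < e"
    then obtain N where N: "inverse (real (Suc N)) < e\<^sup>2 / 4"
      using reals_Archimedean[of "e\<^sup>2 / 4"] by auto
    have "dist (z i) (z j) < e" if "i \<ge> N" "j \<ge> N" for i j
    proof -
      have small: "\<Phi> (z k) - m < e\<^sup>2 / 4" if "k \<ge> N" for k
      proof -
        have "inverse (real (Suc k)) \<le> inverse (real (Suc N))"
          using that by (intro le_imp_inverse_le) auto
        with z[of k] N show ?thesis by linarith
      qed
      have "(norm (z i - z j))\<^sup>2 < e\<^sup>2"
        using near[of "z i" "z j"] small[OF that(1)] small[OF that(2)] by (simp add: field_simps)
      then show ?thesis
        using \<open>0 < e\<close> power_less_imp_less_base[of _ 2 e] unfolding dist_norm by simp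
    qed
    then show "\<exists>M. \<forall>m\<ge>M. \<forall>n\<ge>M. dist (z m) (z n) < e" by blast
  qed
  then obtain y where y: "z \<longlonglongrightarrow> y"
    using convergent_def Cauchy_convergent by blast
  have "(\<lambda>n. \<Phi> (z n)) \<longlonglongrightarrow> \<Phi> y"
    unfolding \<Phi>_def by (intro tendsto_intros y f.tendsto)
  moreover have "(\<lambda>n. m + inverse (real (Suc n))) \<longlonglongrightarrow> m"
    using tendsto_add[OF tendsto_const LIMSEQ_inverse_real_of_nat] by simp
  ultimately have "\<Phi> y \<le> m"
    by (rule LIMSEQ_le) (use z in \<open>auto intro: less_imp_le\<close>)
  then have min: "\<Phi> y \<le> \<Phi> x" for x
    using m_le[of x] by linarith
  have "f x = x \<bullet> y" for x
  proof (rule ccontr)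
    assume "f x \<noteq> x \<bullet> y"
    define d where "d = f x - x \<bullet> y"
    have "d \<noteq> 0" using \<open>f x \<noteq> x \<bullet> y\<close> by (simp add: d_def)
    then have x: "x \<noteq> 0" by (auto simp: d_def f.zero)
    \<comment> \<open>the step along \<open>x\<close> that decreases \<open>\<Phi>\<close> the most\<close>
    define t where "t = d / (norm x)\<^sup>2"
    have "\<Phi> (y + t *\<^sub>R x) = \<Phi> y + t\<^sup>2 * (norm x)\<^sup>2 - 2 * t * d"
      unfolding \<Phi>_def d_def power2_norm_eq_inner
      by (simp add: f.add f.scaleR algebra_simps inner_commute power2_eq_square)
    also have "t\<^sup>2 * (norm x)\<^sup>2 = t * d"
      using x by (simp add: t_def power2_eq_square)
    finally have "t * d \<le> 0" using min[of "y + t *\<^sub>R x"] by (simp add: mult.commute)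
    moreover have "t * d = d\<^sup>2 / (norm x)\<^sup>2"
      by (simp add: t_def power2_eq_square)
    moreover have "d\<^sup>2 / (norm x)\<^sup>2 > 0"
      using x \<open>d \<noteq> 0\<close> by simp
    ultimately show False by linarith
  qed
  then show ?thesis by (rule that)
qed

text \<open>
  Since \<open>adjoint\<close> is a choice of some function with the adjoint property, the identity holds as soon as
  such a function exists; in a Hilbert space Riesz representation provides one.
\<close>

lemma adjoint_bounded_linear:
  fixes f :: "'a::{real_inner, banach} \<Rightarrow> 'b::real_inner"
  assumes "bounded_linear f"
  shows "f x \<bullet> y = x \<bullet> adjoint f y"
proof -
  have "\<exists>z. \<forall>x. f x \<bullet> y = x \<bullet> z" for y
  proof -
    have "bounded_linear (\<lambda>x. f x \<bullet> y)"
      using bounded_linear_compose[OF bounded_linear_inner_left assms] .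
    then show ?thesis using riesz_representation[of "\<lambda>x. f x \<bullet> y"] by metis
  qed
  then have "\<exists>g. \<forall>x y. f x \<bullet> y = x \<bullet> g y" by metis
  then show ?thesis
    unfolding adjoint_def by (rule someI2_ex) blast
qed

text \<open>
  The uniform boundedness principle for the functionals \<open>\<lambda>y. y \<bullet> x\<close> with \<open>x \<in> S\<close>. The closed sets on which
  all of them are at most \<open>n\<close> in absolute value exhaust the space, so by Baire one of them contains a ball
  around some \<open>y\<close>; moving from \<open>y\<close> in the direction of \<open>x \<in> S\<close> then bounds \<open>\<parallel>x\<parallel>\<close>.
\<close>

lemma weakly_bounded_imp_bounded:
  fixes S :: "'a::{real_inner, banach} set"
  assumes "\<And>y. \<exists>c. \<forall>x\<in>S. \<bar>y \<bullet> x\<bar> \<le> c"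
  shows "bounded S"
proof -
  define E where "E n = {y. \<forall>x\<in>S. \<bar>y \<bullet> x\<bar> \<le> real n}" for n
  have "closed (E n)" for n
  proof -
    have "E n = (\<Inter>x\<in>S. {y. \<bar>y \<bullet> x\<bar> \<le> real n})" by (auto simp: E_def)
    then show ?thesis
      by (auto intro!: closed_INT closed_Collect_le continuous_intros)
  qed
  have UN: "(\<Union>n. E n) = UNIV"
  proof -
    have "\<exists>n. y \<in> E n" for y
    proof -
      obtain c where c: "\<forall>x\<in>S. \<bar>y \<bullet> x\<bar> \<le> c" using assms by blast
      obtain n where "c \<le> real n" using real_arch_simple by blast
      with c have "y \<in> E n" by (fastforce simp: E_def)
      then show ?thesis ..
    qed
    then show ?thesis by blast
  qed
  have "\<exists>n. interior (E n) \<noteq> {}"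
  proof (rule ccontr)
    assume "\<not> ?thesis"
    then have "(euclidean :: 'a topology) interior_of (\<Union>(range E)) = {}"
      using \<open>\<And>n. closed (E n)\<close>
      by (intro Baire_category_alt disjI1 completely_metrizable_space_euclidean) auto
    then show False by (simp add: UN)
  qed
  then obtain n y e where "0 < e" and ball: "ball y e \<subseteq> E n"
    by (metis all_not_in_conv mem_interior)
  have "norm x \<le> 4 * real n / e" if "x \<in> S" for x
  proof (cases "x = 0")
    case False
    define z where "z = (e / 2) *\<^sub>R sgn x"
    have "norm z = e / 2" using False \<open>0 < e\<close> by (simp add: z_def norm_sgn)
    then have "y \<in> E n" "y + z \<in> E n"
      using ball \<open>0 < e\<close> by (auto simp: dist_norm)
    then have "\<bar>y \<bullet> x\<bar> \<le> n" "\<bar>y \<bullet> x + z \<bullet> x\<bar> \<le> n"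
      using that by (auto simp: E_def inner_add_left)
    moreover have "z \<bullet> x = e / 2 * norm x"
      using False by (simp add: z_def sgn_div_norm dot_square_norm power2_eq_square)
    ultimately have "e / 2 * norm x \<le> 2 * n" by linarith
    then show ?thesis using \<open>0 < e\<close> by (simp add: field_simps)
  qed (use \<open>0 < e\<close> in simp)
  then show ?thesis unfolding bounded_iff by blast
qed

text \<open>
  The Lax--Milgram theorem. Coercivity makes \<open>I - \<rho> G\<close> a contraction for small \<open>\<rho> > 0\<close>, and a fixed point
  of \<open>x \<mapsto> x - \<rho> (G x - y)\<close> is a solution of \<open>G x = y\<close>.
\<close>

lemma coercive_bounded_linear_surj:
  fixes G :: "'a::{real_inner, banach} \<Rightarrow> 'a"
  assumes "bounded_linear G" and "0 < c" and coercive: "\<And>x. c * (norm x)\<^sup>2 \<le> G x \<bullet> x"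
  shows "surj G"
proof (unfold surj_def, rule allI)
  fix y
  interpret G: bounded_linear G by fact
  obtain K where "0 < K" and K: "\<And>x. norm (G x) \<le> norm x * K"
    using G.pos_bounded by blast
  \<comment> \<open>\<open>c / K\<^sup>2\<close> would be the best \<open>\<rho>\<close>; adding \<open>c\<^sup>2\<close> to the denominator also makes \<open>q\<close> nonnegative\<close>
  define \<rho> where "\<rho> = c / (K\<^sup>2 + c\<^sup>2)"
  define q where "q = 1 - \<rho> * c"
  have D: "0 < K\<^sup>2 + c\<^sup>2" using \<open>0 < K\<close> by (simp add: add_pos_nonneg)
  have "0 < \<rho>" using D \<open>0 < c\<close> by (simp add: \<rho>_def)
  have q: "0 \<le> q" "q < 1"
    using D \<open>0 < c\<close> \<open>0 < \<rho>\<close> \<open>0 < K\<close> by (auto simp: q_def \<rho>_def field_simps power2_eq_square)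
  have contr: "norm (x - \<rho> *\<^sub>R G x) \<le> sqrt q * norm x" for x
  proof -
    have "(norm (x - \<rho> *\<^sub>R G x))\<^sup>2 = (norm x)\<^sup>2 - 2 * \<rho> * (G x \<bullet> x) + \<rho>\<^sup>2 * (norm (G x))\<^sup>2"
      unfolding power2_norm_eq_inner
      by (simp add: algebra_simps inner_commute power2_eq_square)
    also have "\<dots> \<le> (norm x)\<^sup>2 - 2 * \<rho> * (c * (norm x)\<^sup>2) + \<rho>\<^sup>2 * (norm x * K)\<^sup>2"
      using coercive[of x] K[of x] \<open>0 < \<rho>\<close>
      by (intro add_mono diff_mono mult_left_mono power_mono) auto
    also have "\<dots> = (1 - 2 * \<rho> * c + \<rho>\<^sup>2 * K\<^sup>2) * (norm x)\<^sup>2"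
      by (simp add: algebra_simps power_mult_distrib)
    also have "\<dots> \<le> q * (norm x)\<^sup>2"
    proof (rule mult_right_mono)
      have "\<rho> * K\<^sup>2 \<le> c"
        using D \<open>0 < c\<close> by (simp add: \<rho>_def field_simps)
      then have "\<rho> * (\<rho> * K\<^sup>2) \<le> \<rho> * c"
        using \<open>0 < \<rho>\<close> by (intro mult_left_mono) auto
      then show "1 - 2 * \<rho> * c + \<rho>\<^sup>2 * K\<^sup>2 \<le> q"
        by (simp add: q_def power2_eq_square mult.assoc)
    qed simp
    finally have "sqrt ((norm (x - \<rho> *\<^sub>R G x))\<^sup>2) \<le> sqrt (q * (norm x)\<^sup>2)"
      by (rule real_sqrt_le_mono)
    then show ?thesis by (simp add: real_sqrt_mult)
  qed
  define T where "T x = x - \<rho> *\<^sub>R (G x - y)" for x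
  have "\<exists>!x\<in>UNIV. T x = x"
  proof (rule Banach_fix)
    show "dist (T a) (T b) \<le> sqrt q * dist a b" for a b
      using contr[of "a - b"] by (simp add: T_def dist_norm G.diff algebra_simps)
  qed (use q complete_UNIV in auto)
  then obtain x where "T x = x" by blast
  then show "\<exists>x. y = G x" using \<open>0 < \<rho>\<close> by (auto simp: T_def)
qed

section \<open>Strong measurability and the strong integral\<close>

lemma complete_measure_restrict_space:
  assumes "complete_measure M" "\<Omega> \<in> sets M"
  shows "complete_measure (restrict_space M \<Omega>)"
proof
  fix A B :: "'a set"
  assume "B \<subseteq> A" "A \<in> null_sets (restrict_space M \<Omega>)"
  then have "B \<in> sets M" "B \<subseteq> \<Omega>"
    using assms complete_measure.complete[of M B A] by (auto simp: null_sets_restrict_space)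
  then show "B \<in> sets (restrict_space M \<Omega>)"
    using assms by (auto simp: sets_restrict_space_iff)
qed

text \<open>
  Strong measurability controls a function only almost everywhere; completeness of the measure turns this
  into measurability of its scalar images.
\<close>

lemma (in complete_measure) measurable_cong_AE_complete:
  assumes f: "f \<in> measurable M N" and ae: "AE x in M. f x = g x"
    and g: "g \<in> space M \<rightarrow> space N"
  shows "g \<in> measurable M N"
proof (rule measurableI)
  show "g x \<in> space N" if "x \<in> space M" for x using g that by auto
next
  fix A assume "A \<in> sets N"
  have "AE x in M. x \<in> f -` A \<inter> space M \<longleftrightarrow> x \<in> g -` A \<inter> space M"
    using ae by eventually_elim auto
  then show "g -` A \<inter> space M \<in> sets M"
    using measurable_sets[OF f \<open>A \<in> sets N\<close>] by (rule in_sets_AE) auto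
qed

lemma strongly_measurable_compose_continuous:
  fixes f :: "'a \<Rightarrow> 'b::real_normed_vector" and g :: "'b \<Rightarrow> real"
  assumes "complete_measure M" and f: "strongly_measurable M f" and g: "continuous_on UNIV g"
  shows "(\<lambda>x. g (f x)) \<in> borel_measurable M"
proof -
  interpret complete_measure M by fact
  obtain \<phi> where \<phi>: "\<And>i::nat. simple_function M (\<phi> i)"
    and lim: "AE x in M. (\<lambda>i. \<phi> i x) \<longlonglongrightarrow> f x"
    using f unfolding strongly_measurable_def by blast
  obtain N where N: "\<And>x. x \<in> space M - N \<Longrightarrow> (\<lambda>i. \<phi> i x) \<longlonglongrightarrow> f x" "N \<in> null_sets M"
    using AE_E3[OF lim] by blast
  then have [measurable]: "N \<in> sets M" by auto
  have [measurable]: "(\<lambda>x. g (\<phi> i x)) \<in> borel_measurable M" for i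
    by (rule borel_measurable_simple_function[OF simple_function_compose1[OF \<phi>]])
  \<comment> \<open>off \<open>N\<close> the simple approximations converge everywhere\<close>
  have "(\<lambda>x. if x \<in> N then 0 else g (f x)) \<in> borel_measurable M"
  proof (rule borel_measurable_LIMSEQ_real)
    show "(\<lambda>i. if x \<in> N then 0 else g (\<phi> i x)) \<longlonglongrightarrow> (if x \<in> N then 0 else g (f x))"
      if "x \<in> space M" for x
      using continuous_on_tendsto_compose[OF g N(1)[of x]] that by (cases "x \<in> N") simp_all
  qed measurable
  moreover have "AE x in M. (if x \<in> N then 0 else g (f x)) = g (f x)"
    using AE_not_in[OF N(2)] by eventually_elim simp
  ultimately show ?thesis
    by (rule measurable_cong_AE_complete) auto
qed

lemma strongly_measurable_diff_simple:
  assumes "strongly_measurable M f" and "simple_function M g"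
  shows "strongly_measurable M (\<lambda>x. f x - g x)"
proof -
  obtain \<phi> where \<phi>: "\<And>i::nat. simple_function M (\<phi> i)"
    and lim: "AE x in M. (\<lambda>i. \<phi> i x) \<longlonglongrightarrow> f x"
    using assms unfolding strongly_measurable_def by blast
  have "AE x in M. (\<lambda>i. \<phi> i x - g x) \<longlonglongrightarrow> f x - g x"
    using lim by eventually_elim (intro tendsto_intros)
  moreover have "simple_function M (\<lambda>x. \<phi> i x - g x)" for i
    by (rule simple_function_compose2[OF \<phi> assms(2)])
  ultimately show ?thesis
    unfolding strongly_measurable_def by (intro exI[of _ "\<lambda>i x. \<phi> i x - g x"]) auto
qed

lemma strongly_measurable_If_zero:
  assumes "strongly_measurable M f" and "{x \<in> space M. P x} \<in> sets M"
  shows "strongly_measurable M (\<lambda>x. if P x then f x else 0)"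
proof -
  obtain \<phi> where \<phi>: "\<And>i::nat. simple_function M (\<phi> i)"
    and lim: "AE x in M. (\<lambda>i. \<phi> i x) \<longlonglongrightarrow> f x"
    using assms unfolding strongly_measurable_def by blast
  have "AE x in M. (\<lambda>i. if P x then \<phi> i x else 0) \<longlonglongrightarrow> (if P x then f x else 0)"
    using lim by eventually_elim auto
  moreover have "simple_function M (\<lambda>x. if P x then \<phi> i x else 0)" for i
    by (intro simple_function_If \<phi> assms) auto
  ultimately show ?thesis
    unfolding strongly_measurable_def by (intro exI[of _ "\<lambda>i x. if P x then \<phi> i x else 0"]) auto
qed

lemma strongly_measurable_const: "strongly_measurable M (\<lambda>x. c)"
  unfolding strongly_measurable_def by (intro exI[of _ "\<lambda>_ _. c"]) auto

text \<open>
  The strong integral commutes with continuous functionals. As the scalar integral is unique, this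
  also makes the strong integral unique, hence its definition by description meaningful.
\<close>

lemma has_strong_integral_inner:
  fixes f :: "'a \<Rightarrow> 'b::real_inner"
  assumes "complete_measure M" and "has_strong_integral M f y"
  shows "has_bochner_integral M (\<lambda>s. f s \<bullet> x) (y \<bullet> x)"
proof -
  obtain \<phi> where f: "strongly_measurable M f"
    and sb: "\<And>i::nat. Bochner_Integration.simple_bochner_integrable M (\<phi> i)"
    and L1: "(\<lambda>i. \<integral>\<^sup>+s. norm (f s - \<phi> i s) \<partial>M) \<longlonglongrightarrow> 0"
    and lim: "(\<lambda>i. Bochner_Integration.simple_bochner_integral M (\<phi> i)) \<longlonglongrightarrow> y"
    using assms(2) unfolding has_strong_integral_def by blast
  have \<phi>: "simple_function M (\<phi> i)" for i
    using sb[of i] by (auto elim: simple_bochner_integrable.cases)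
  show ?thesis
  proof (rule has_bochner_integral.intros)
    show "(\<lambda>s. f s \<bullet> x) \<in> borel_measurable M"
      by (rule strongly_measurable_compose_continuous[OF assms(1) f]) (intro continuous_intros)
    show "Bochner_Integration.simple_bochner_integrable M (\<lambda>s. \<phi> i s \<bullet> x)" for i
      using simple_bochner_integrable_compose2[of "\<lambda>u v. u \<bullet> x", OF _ sb sb] by simp
    show "(\<lambda>i. Bochner_Integration.simple_bochner_integral M (\<lambda>s. \<phi> i s \<bullet> x)) \<longlonglongrightarrow> y \<bullet> x"
    proof -
      have "linear (\<lambda>v. v \<bullet> x)"
        by (rule bounded_linear.linear[OF bounded_linear_inner_left])
      from simple_bochner_integral_linear[OF this sb] show ?thesis
        by (simp only:) (intro tendsto_intros lim)
    qed
    show "(\<lambda>i. \<integral>\<^sup>+s. norm (f s \<bullet> x - \<phi> i s \<bullet> x) \<partial>M) \<longlonglongrightarrow> 0"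
    proof -
      have upper: "\<forall>\<^sub>F i in sequentially. (\<integral>\<^sup>+s. norm (f s \<bullet> x - \<phi> i s \<bullet> x) \<partial>M)
          \<le> ennreal (norm x) * (\<integral>\<^sup>+s. norm (f s - \<phi> i s) \<partial>M)"
      proof (intro always_eventually allI)
        fix i
        have [measurable]: "(\<lambda>s. norm (f s - \<phi> i s)) \<in> borel_measurable M"
          by (rule strongly_measurable_compose_continuous[OF assms(1)
                strongly_measurable_diff_simple[OF f \<phi>]]) (intro continuous_intros)
        have "(\<integral>\<^sup>+s. norm (f s \<bullet> x - \<phi> i s \<bullet> x) \<partial>M)
            \<le> (\<integral>\<^sup>+s. ennreal (norm x) * norm (f s - \<phi> i s) \<partial>M)"
          by (intro nn_integral_mono)
            (auto simp flip: inner_diff_left ennreal_mult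
              intro!: Cauchy_Schwarz_ineq2[THEN order_trans] simp: mult.commute)
        also have "\<dots> = ennreal (norm x) * (\<integral>\<^sup>+s. norm (f s - \<phi> i s) \<partial>M)"
          by (intro nn_integral_cmult) measurable
        finally show "(\<integral>\<^sup>+s. norm (f s \<bullet> x - \<phi> i s \<bullet> x) \<partial>M)
            \<le> ennreal (norm x) * (\<integral>\<^sup>+s. norm (f s - \<phi> i s) \<partial>M)" .
      qed
      have "(\<lambda>i. ennreal (norm x) * (\<integral>\<^sup>+s. norm (f s - \<phi> i s) \<partial>M)) \<longlonglongrightarrow> 0"
        using ennreal_tendsto_cmult[OF _ L1] by simp
      then show ?thesis
        by (intro tendsto_sandwich[OF _ upper tendsto_const]) auto
    qed
  qed
qed

lemma has_strong_integral_unique: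
  fixes f :: "'a \<Rightarrow> 'b::real_inner"
  assumes "complete_measure M" "has_strong_integral M f y" "has_strong_integral M f z"
  shows "y = z"
proof -
  have "y \<bullet> (y - z) = z \<bullet> (y - z)"
    by (rule has_bochner_integral_eq[OF assms(2,3)[THEN has_strong_integral_inner[OF assms(1)]]])
  then have "(y - z) \<bullet> (y - z) = 0" by (simp only: inner_diff_left right_minus_eq)
  then show ?thesis by simp
qed

lemma has_strong_integral_strong_integral:
  fixes f :: "'a \<Rightarrow> 'b::real_inner"
  assumes "complete_measure M" "strongly_integrable M f"
  shows "has_strong_integral M f (strong_integral M f)"
proof -
  obtain y where y: "has_strong_integral M f y"
    using assms(2) unfolding strongly_integrable_def by blast
  then show ?thesis
    unfolding strong_integral_def
    by (rule theI) (rule has_strong_integral_unique[OF assms(1) _ y])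
qed

section \<open>Pettis measurability in inner product spaces\<close>

text \<open>
  The normalised elements of \<open>W\<close> form a norming set for \<open>closure W\<close>: if \<open>w \<longlonglongrightarrow> z \<noteq> 0\<close> along \<open>W\<close>, then
  \<open>z \<bullet> sgn w \<longlonglongrightarrow> \<parallel>z\<parallel>\<close>. For countable \<open>W\<close> this describes the norm by countably many functionals.
\<close>

lemma norm_le_iff_inner_sgn_le:
  fixes z :: "'a::real_inner"
  assumes "z \<in> closure W" "0 \<le> c"
  shows "norm z \<le> c \<longleftrightarrow> (\<forall>w\<in>W. z \<bullet> sgn w \<le> c)"
proof
  assume "norm z \<le> c"
  have "z \<bullet> sgn w \<le> norm z" for w
    using Cauchy_Schwarz_ineq2[of z "sgn w"] by (auto simp: norm_sgn split: if_splits)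
  then show "\<forall>w\<in>W. z \<bullet> sgn w \<le> c" using \<open>norm z \<le> c\<close> by (blast intro: order_trans)
next
  assume le: "\<forall>w\<in>W. z \<bullet> sgn w \<le> c"
  show "norm z \<le> c"
  proof (cases "z = 0")
    case False
    obtain w where w: "\<And>n. w n \<in> W" "w \<longlonglongrightarrow> z"
      using assms(1) closure_sequential by blast
    have "(\<lambda>n. z \<bullet> sgn (w n)) \<longlonglongrightarrow> z \<bullet> sgn z"
      using False by (intro tendsto_intros w)
    then have "z \<bullet> sgn z \<le> c"
      by (rule LIMSEQ_le_const2) (use le w in auto)
    moreover have "z \<bullet> sgn z = norm z"
      using False by (simp add: sgn_div_norm dot_square_norm power2_eq_square)
    ultimately show ?thesis by simp
  qed (use assms in simp)
qed

text \<open>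
  The values \<open>f x - d\<close> lie in the closure of the countable set \<open>D - d\<close>, so their norm is a supremum of
  countably many measurable scalar functions.
\<close>

lemma borel_measurable_dist_weakly_measurable:
  fixes f :: "'a \<Rightarrow> 'b::real_inner"
  assumes weak: "\<And>v. (\<lambda>x. f x \<bullet> v) \<in> borel_measurable M"
    and D: "countable D" "\<And>x. x \<in> space M \<Longrightarrow> f x \<in> closure D"
  shows "(\<lambda>x. dist (f x) d) \<in> borel_measurable M"
proof (rule borel_measurableI_le)
  fix c :: real
  have [measurable]: "(\<lambda>x. (f x - d) \<bullet> v) \<in> borel_measurable M" for v
    using weak[of v] by (simp add: inner_diff_left)
  show "{x \<in> space M. dist (f x) d \<le> c} \<in> sets M"
  proof (cases "0 \<le> c")
    case True
    have "dist (f x) d \<le> c \<longleftrightarrow> (\<forall>e\<in>D. (f x - d) \<bullet> sgn (e - d) \<le> c)" if "x \<in> space M" for x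
    proof -
      have "f x - d \<in> closure ((\<lambda>e. e - d) ` D)"
        using D(2)[OF that] closure_translation_subtract[of d D] by auto
      from norm_le_iff_inner_sgn_le[OF this True] show ?thesis
        by (simp add: dist_norm)
    qed
    then have "{x \<in> space M. dist (f x) d \<le> c}
        = {x \<in> space M. \<forall>e\<in>D. (f x - d) \<bullet> sgn (e - d) \<le> c}" by auto
    also have "\<dots> \<in> sets M" using D(1) by measurable
    finally show ?thesis .
  next
    case False
    then have "\<not> dist (f x) d \<le> c" for x
      using zero_le_dist[of "f x" d] by linarith
    then have "{x \<in> space M. dist (f x) d \<le> c} = {}" by blast
    then show ?thesis by (simp only: sets.empty_sets)
  qed
qed

text \<open>
  \<open>nearest e n y\<close> is the point of \<open>e 0, \<dots>, e n\<close> closest to \<open>y\<close>, the first one in case of a tie. The recursion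
  follows the comparison of one new candidate with the best old one, which keeps the composition with a
  measurable function simple.
\<close>

fun nearest :: "(nat \<Rightarrow> 'b::metric_space) \<Rightarrow> nat \<Rightarrow> 'b \<Rightarrow> 'b" where
  "nearest e 0 y = e 0"
| "nearest e (Suc n) y = (if dist y (e (Suc n)) < dist y (nearest e n y) then e (Suc n)
    else nearest e n y)"

lemma dist_nearest_le: "k \<le> n \<Longrightarrow> dist y (nearest e n y) \<le> dist y (e k)"
  by (induction n) (auto simp: le_Suc_eq)

lemma nearest_tendsto:
  assumes "y \<in> closure (range e)"
  shows "(\<lambda>n. nearest e n y) \<longlonglongrightarrow> y"
proof (rule metric_LIMSEQ_I)
  fix r :: real assume "0 < r"
  then obtain k where "dist (e k) y < r"
    using assms unfolding closure_approachable by blast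
  then show "\<exists>N. \<forall>n\<ge>N. dist (nearest e n y) y < r"
    using dist_nearest_le[of k _ y e] by (metis dist_commute le_less_trans)
qed

text \<open>
  The two claims are proved together because the comparison in the next step involves the distance to
  the current nearest point.
\<close>

lemma nearest_simple_function:
  assumes "\<And>d. (\<lambda>x. dist (f x) d) \<in> borel_measurable M"
  shows "simple_function M (\<lambda>x. nearest e n (f x))
    \<and> (\<lambda>x. dist (f x) (nearest e n (f x))) \<in> borel_measurable M"
proof (induction n)
  case (Suc n)
  then have [measurable]: "(\<lambda>x. dist (f x) (nearest e n (f x))) \<in> borel_measurable M" by blast
  note [measurable] = assms
  have "simple_function M (\<lambda>x. nearest e (Suc n) (f x))"
    unfolding nearest.simps
    by (rule simple_function_If) (use Suc in auto)
  moreover have "dist y (nearest e (Suc n) y) = min (dist y (e (Suc n))) (dist y (nearest e n y))" for y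
    by simp
  ultimately show ?case by (simp del: nearest.simps)
qed (use assms in simp)

text \<open>
  Enumerate a countable set whose closure contains almost all values. Rounding \<open>f x\<close> to the nearest of
  the first \<open>n\<close> points gives simple functions converging to \<open>f\<close>; they are measurable because the distances
  to fixed points are, and those are determined by the weakly measurable scalar functions.
\<close>

lemma Pettis_measurability:
  fixes f :: "'a \<Rightarrow> 'b::real_inner"
  assumes weak: "\<And>v. (\<lambda>x. f x \<bullet> v) \<in> borel_measurable M"
    and sep: "ae_separably_valued M f"
  shows "strongly_measurable M f"
proof -
  obtain D where D: "countable D" and ae: "AE x in M. f x \<in> closure D"
    using sep unfolding ae_separably_valued_def by blast
  obtain N where N: "\<And>x. x \<in> space M - N \<Longrightarrow> f x \<in> closure D" "N \<in> null_sets M"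
    using AE_E3[OF ae] by blast
  then have [measurable]: "N \<in> sets M" by auto
  \<comment> \<open>\<open>0\<close> joins the countable set as the value on the exceptional null set\<close>
  define g where "g x = (if x \<in> N then 0 else f x)" for x
  define e where "e = from_nat_into (insert 0 D)"
  have e: "range e = insert 0 D"
    using D by (simp add: e_def)
  have g_closure: "g x \<in> closure (range e)" if "x \<in> space M" for x
    using N(1)[of x] that closure_mono[of D "insert 0 D"] closure_subset[of "insert 0 D"]
    by (auto simp: g_def e)
  have "(\<lambda>x. g x \<bullet> v) \<in> borel_measurable M" for v
  proof -
    note [measurable] = weak[of v]
    have "(\<lambda>x. g x \<bullet> v) = (\<lambda>x. if x \<in> N then 0 else f x \<bullet> v)"
      by (auto simp: g_def)
    then show ?thesis by simp
  qed
  then have "(\<lambda>x. dist (g x) d) \<in> borel_measurable M" for d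
    by (rule borel_measurable_dist_weakly_measurable[where D = "range e"])
      (use g_closure in auto)
  then have "simple_function M (\<lambda>x. nearest e n (g x))" for n
    using nearest_simple_function[of g M e n] by blast
  moreover have "AE x in M. (\<lambda>n. nearest e n (g x)) \<longlonglongrightarrow> f x"
    using AE_not_in[OF N(2)] AE_space
  proof eventually_elim
    case (elim x)
    then show ?case using nearest_tendsto[OF g_closure[OF elim(2)]] by (simp add: g_def)
  qed
  ultimately show ?thesis
    unfolding strongly_measurable_def by (intro exI[of _ "\<lambda>n x. nearest e n (g x)"]) auto
qed

section \<open>The input map and its adjoint\<close>

text \<open>
  This is the adjoint of \<open>input_map V B \<tau>\<close> at \<open>x\<close>, that is the output of the dual system; so far it is only
  a function of \<open>s\<close>, and not yet known to be square integrable.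
\<close>

definition observation ::
    "(real \<Rightarrow> real \<Rightarrow> 'h::real_inner \<Rightarrow>\<^sub>L 'h) \<Rightarrow> (real \<Rightarrow> 'u::real_inner \<Rightarrow>\<^sub>L 'h)
      \<Rightarrow> real \<Rightarrow> 'h \<Rightarrow> real \<Rightarrow> 'u" where
  "observation V B \<tau> x s = adjoint (B s) (adjoint (V \<tau> s) x)"

lemma inner_observation:
  fixes V :: "real \<Rightarrow> real \<Rightarrow> 'h::{real_inner, banach} \<Rightarrow>\<^sub>L 'h"
    and B :: "real \<Rightarrow> 'u::{real_inner, banach} \<Rightarrow>\<^sub>L 'h"
  shows "v \<bullet> observation V B \<tau> x s = V \<tau> s (B s v) \<bullet> x"
  unfolding observation_def
  by (simp only: adjoint_bounded_linear[OF blinfun.bounded_linear_right, symmetric])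

lemma linear_observation:
  fixes V :: "real \<Rightarrow> real \<Rightarrow> 'h::{real_inner, banach} \<Rightarrow>\<^sub>L 'h"
    and B :: "real \<Rightarrow> 'u::{real_inner, banach} \<Rightarrow>\<^sub>L 'h"
  shows "linear (\<lambda>x. observation V B \<tau> x s)"
proof (rule linearI)
  have eqI: "a = b" if "\<And>v. v \<bullet> a = v \<bullet> b" for a b :: 'u
    using that by (metis inner_commute vector_eq_rdot)
  show "observation V B \<tau> (x + y) s = observation V B \<tau> x s + observation V B \<tau> y s" for x y
    by (rule eqI) (simp add: inner_observation inner_add_right)
  show "observation V B \<tau> (c *\<^sub>R x) s = c *\<^sub>R observation V B \<tau> x s" for c x
    by (rule eqI) (simp add: inner_observation)
qed

lemma complete_measure_lebesgue_on: "complete_measure (lebesgue_on {a..b::real})"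
  by (intro complete_measure_restrict_space completion.complete_measure_axioms) auto

lemma power2_L2_norm: "(L2_norm \<tau> u)\<^sup>2 = (LINT s|lebesgue_on {0..\<tau>}. (norm (u s))\<^sup>2)"
  unfolding L2_norm_def by (simp add: integral_nonneg)

lemma L2_bounded:
  assumes "strongly_measurable (lebesgue_on {0..\<tau>}) u" and "\<And>s. norm (u s) \<le> c"
  shows "u \<in> L2 \<tau>"
proof -
  interpret finite_measure "lebesgue_on {0..\<tau>}"
    by (intro finite_measure_lebesgue_on) auto
  have "(\<lambda>s. (norm (u s))\<^sup>2) \<in> borel_measurable (lebesgue_on {0..\<tau>})"
    by (rule strongly_measurable_compose_continuous[OF complete_measure_lebesgue_on assms(1)])
      (intro continuous_intros)
  then have "integrable (lebesgue_on {0..\<tau>}) (\<lambda>s. (norm (u s))\<^sup>2)"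
    using assms(2) by (intro integrable_const_bound[where B = "c\<^sup>2"]) (auto intro!: power_mono)
  then show ?thesis using assms(1) by (simp add: L2_def)
qed

text \<open>
  Monotone convergence, in the form used to show that the observation is square integrable.
\<close>

lemma integrable_of_bounded_truncations:
  fixes f :: "'a \<Rightarrow> real"
  assumes [measurable]: "f \<in> borel_measurable M" and nonneg: "\<And>x. 0 \<le> f x"
    and int: "\<And>n::nat. integrable M (\<lambda>x. if f x \<le> n then f x else 0)"
    and le: "\<And>n::nat. (LINT x|M. (if f x \<le> n then f x else 0)) \<le> c"
  shows "integrable M f"
proof (rule integrableI_bounded)
  have "(\<lambda>n::nat. \<integral>\<^sup>+x. ennreal (if f x \<le> n then f x else 0) \<partial>M) \<longlonglongrightarrow> (\<integral>\<^sup>+x. ennreal (f x) \<partial>M)"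
  proof (rule nn_integral_LIMSEQ)
    show "incseq (\<lambda>n x. ennreal (if f x \<le> real n then f x else 0))"
      using nonneg by (auto simp: incseq_def le_fun_def)
    fix x
    obtain k where "f x \<le> real k" using real_arch_simple by blast
    then have "\<forall>\<^sub>F n in sequentially. ennreal (if f x \<le> real n then f x else 0) = ennreal (f x)"
      unfolding eventually_sequentially by (intro exI[of _ k]) auto
    then show "(\<lambda>n. ennreal (if f x \<le> real n then f x else 0)) \<longlonglongrightarrow> ennreal (f x)"
      by (rule tendsto_eventually)
  qed measurable
  moreover have "(\<integral>\<^sup>+x. ennreal (if f x \<le> n then f x else 0) \<partial>M) \<le> ennreal c" for n :: nat
    using nn_integral_eq_integral[OF int, of n] nonneg le[of n] by (simp add: ennreal_leI)
  ultimately have "(\<integral>\<^sup>+x. ennreal (f x) \<partial>M) \<le> ennreal c"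
    by (intro LIMSEQ_le_const2) auto
  then show "(\<integral>\<^sup>+x. ennreal (norm (f x)) \<partial>M) < \<infinity>"
    using nonneg by (simp add: le_less_trans[OF _ ennreal_less_top])
qed measurable

text \<open>
  The duality \<open>\<langle>\<Psi> u, x\<rangle> = \<langle>u, \<Psi>\<^sup>* x\<rangle>\<close>, obtained by pulling \<open>x\<close> under the integral. In particular the pairing
  \<open>u \<bullet> observation V B \<tau> x\<close> is integrable for every control \<open>u\<close>.
\<close>

lemma input_map_inner:
  fixes V :: "real \<Rightarrow> real \<Rightarrow> 'h::{real_inner, banach} \<Rightarrow>\<^sub>L 'h"
    and B :: "real \<Rightarrow> 'u::{real_inner, banach} \<Rightarrow>\<^sub>L 'h"
  assumes "admissible \<tau> V B" "u \<in> L2 \<tau>"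
  shows "has_bochner_integral (lebesgue_on {0..\<tau>}) (\<lambda>s. u s \<bullet> observation V B \<tau> x s)
    (input_map V B \<tau> u \<bullet> x)"
proof -
  have "strongly_integrable (lebesgue_on {0..\<tau>}) (\<lambda>s. V \<tau> s (B s (u s)))"
    using assms unfolding admissible_def by blast
  then show ?thesis
    unfolding inner_observation input_map_def
    by (intro has_strong_integral_inner has_strong_integral_strong_integral
        complete_measure_lebesgue_on)
qed

text \<open>
  Constant controls are square integrable, so admissibility makes the observation weakly measurable.
\<close>

lemma strongly_measurable_observation:
  fixes V :: "real \<Rightarrow> real \<Rightarrow> 'h::{real_inner, banach} \<Rightarrow>\<^sub>L 'h"
    and B :: "real \<Rightarrow> 'u::{real_inner, banach} \<Rightarrow>\<^sub>L 'h"
  assumes "admissible \<tau> V B"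
    and "ae_separably_valued (lebesgue_on {0..\<tau>}) (observation V B \<tau> x)"
  shows "strongly_measurable (lebesgue_on {0..\<tau>}) (observation V B \<tau> x)"
proof (rule Pettis_measurability[OF _ assms(2)])
  fix v :: 'u
  have "(\<lambda>_. v) \<in> L2 \<tau>"
    by (rule L2_bounded[OF strongly_measurable_const order_refl])
  from input_map_inner[OF assms(1) this, of x]
  show "(\<lambda>s. observation V B \<tau> x s \<bullet> v) \<in> borel_measurable (lebesgue_on {0..\<tau>})"
    by (subst inner_commute) (auto elim: has_bochner_integral.cases)
qed

text \<open>
  Testing the duality with the truncation \<open>u\<close> of the observation gives
  \<open>\<parallel>u\<parallel>\<^sup>2 = \<langle>\<Psi> u, x\<rangle> \<le> K \<parallel>u\<parallel> \<parallel>x\<parallel>\<close>. Dividing by \<open>\<parallel>u\<parallel>\<close>, which is finite because \<open>u\<close> is bounded, leaves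
  \<open>\<parallel>u\<parallel> \<le> K \<parallel>x\<parallel>\<close> independently of the truncation.
\<close>

lemma observation_in_L2:
  fixes V :: "real \<Rightarrow> real \<Rightarrow> 'h::{real_inner, banach} \<Rightarrow>\<^sub>L 'h"
    and B :: "real \<Rightarrow> 'u::{real_inner, banach} \<Rightarrow>\<^sub>L 'h"
  assumes adm: "admissible \<tau> V B"
    and sep: "ae_separably_valued (lebesgue_on {0..\<tau>}) (observation V B \<tau> x)"
  shows "observation V B \<tau> x \<in> L2 \<tau>"
proof -
  let ?M = "lebesgue_on {0..\<tau>}" and ?F = "observation V B \<tau> x"
  obtain K where K: "\<And>u. u \<in> L2 \<tau> \<Longrightarrow> norm (input_map V B \<tau> u) \<le> K * L2_norm \<tau> u"
    using adm unfolding admissible_def by blast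
  have F: "strongly_measurable ?M ?F"
    using strongly_measurable_observation[OF adm sep] .
  have [measurable]: "(\<lambda>s. (norm (?F s))\<^sup>2) \<in> borel_measurable ?M"
    by (rule strongly_measurable_compose_continuous[OF complete_measure_lebesgue_on F])
      (intro continuous_intros)
  have trunc: "has_bochner_integral ?M (\<lambda>s. if (norm (?F s))\<^sup>2 \<le> n then (norm (?F s))\<^sup>2 else 0) J
      \<Longrightarrow> J \<le> (K * norm x)\<^sup>2"
    "integrable ?M (\<lambda>s. if (norm (?F s))\<^sup>2 \<le> n then (norm (?F s))\<^sup>2 else 0)" for n J :: real
  proof -
    define u where "u s = (if (norm (?F s))\<^sup>2 \<le> n then ?F s else 0)" for s
    have "norm (u s) \<le> sqrt \<bar>n\<bar>" for s
      by (auto simp: u_def intro!: real_le_rsqrt)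
    moreover have "strongly_measurable ?M u"
      unfolding u_def by (intro strongly_measurable_If_zero F) measurable
    ultimately have u: "u \<in> L2 \<tau>" by (rule L2_bounded[rotated])
    have eq: "u s \<bullet> ?F s = (if (norm (?F s))\<^sup>2 \<le> n then (norm (?F s))\<^sup>2 else 0)"
      "(norm (u s))\<^sup>2 = (if (norm (?F s))\<^sup>2 \<le> n then (norm (?F s))\<^sup>2 else 0)" for s
      by (auto simp: u_def dot_square_norm)
    note int = input_map_inner[OF adm u, of x, unfolded eq(1)]
    then show "integrable ?M (\<lambda>s. if (norm (?F s))\<^sup>2 \<le> n then (norm (?F s))\<^sup>2 else 0)"
      by (rule integrable.intros)
    assume J: "has_bochner_integral ?M (\<lambda>s. if (norm (?F s))\<^sup>2 \<le> n then (norm (?F s))\<^sup>2 else 0) J"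
    have "J = (L2_norm \<tau> u)\<^sup>2"
      using has_bochner_integral_integral_eq[OF J] by (simp add: power2_L2_norm eq(2))
    moreover have "J \<le> K * L2_norm \<tau> u * norm x"
    proof -
      have "J = input_map V B \<tau> u \<bullet> x" by (rule has_bochner_integral_eq[OF J int])
      also have "\<dots> \<le> norm (input_map V B \<tau> u) * norm x" by (rule norm_cauchy_schwarz)
      also have "\<dots> \<le> K * L2_norm \<tau> u * norm x"
        by (intro mult_right_mono K u norm_ge_zero)
      finally show ?thesis .
    qed
    ultimately have "L2_norm \<tau> u * L2_norm \<tau> u \<le> K * norm x * L2_norm \<tau> u"
      by (simp add: power2_eq_square mult_ac)
    moreover have "0 \<le> L2_norm \<tau> u" by (simp add: L2_norm_def integral_nonneg)
    ultimately have "L2_norm \<tau> u = 0 \<or> 0 \<le> L2_norm \<tau> u \<and> L2_norm \<tau> u \<le> K * norm x"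
      by (auto simp: mult_le_cancel_right)
    then show "J \<le> (K * norm x)\<^sup>2"
      unfolding \<open>J = (L2_norm \<tau> u)\<^sup>2\<close> by (auto intro: power_mono)
  qed
  have "integrable ?M (\<lambda>s. (norm (?F s))\<^sup>2)"
  proof (rule integrable_of_bounded_truncations)
    fix n :: nat
    show "integrable ?M (\<lambda>s. if (norm (?F s))\<^sup>2 \<le> n then (norm (?F s))\<^sup>2 else 0)"
      by (rule trunc(2))
    then show "(LINT s|?M. (if (norm (?F s))\<^sup>2 \<le> n then (norm (?F s))\<^sup>2 else 0)) \<le> (K * norm x)\<^sup>2"
      by (intro trunc(1)[of n] has_bochner_integral_integrable)
  qed auto
  with F show ?thesis by (simp add: L2_def)
qed

section \<open>Controllability and observability\<close>

lemma exactly_controllable_iff_input_map_surj: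
  "exactly_controllable \<tau> V B \<longleftrightarrow> (\<forall>y. \<exists>u\<in>L2 \<tau>. input_map V B \<tau> u = y)"
proof
  assume "exactly_controllable \<tau> V B"
  then have "\<exists>u\<in>L2 \<tau>. solution V B 0 u \<tau> = y" for y
    unfolding exactly_controllable_def by blast
  then show "\<forall>y. \<exists>u\<in>L2 \<tau>. input_map V B \<tau> u = y"
    by (simp add: solution_def blinfun.zero_right)
next
  assume surj: "\<forall>y. \<exists>u\<in>L2 \<tau>. input_map V B \<tau> u = y"
  have "\<exists>u\<in>L2 \<tau>. solution V B x0 u \<tau> = x1" for x0 x1
    using surj[rule_format, of "x1 - V \<tau> 0 x0"] by (force simp: solution_def)
  then show "exactly_controllable \<tau> V B"
    unfolding exactly_controllable_def by blast
qed

text \<open>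
  If \<open>y = \<Psi> u\<close>, then \<open>\<langle>y, x\<rangle> = \<langle>u, \<Psi>\<^sup>* x\<rangle>\<close> is bounded over all \<open>x\<close> with \<open>\<parallel>\<Psi>\<^sup>* x\<parallel> \<le> 1\<close>. As every \<open>y\<close> has this form,
  these \<open>x\<close> form a weakly bounded, hence bounded set, and homogeneity turns its bound into the constant \<open>C\<close>.
\<close>

lemma input_map_surj_imp_observability:
  fixes V :: "real \<Rightarrow> real \<Rightarrow> 'h::{real_inner, banach} \<Rightarrow>\<^sub>L 'h"
    and B :: "real \<Rightarrow> 'u::{real_inner, banach} \<Rightarrow>\<^sub>L 'h"
  assumes adm: "admissible \<tau> V B"
    and sep: "\<And>x. ae_separably_valued (lebesgue_on {0..\<tau>}) (observation V B \<tau> x)"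
    and surj: "\<And>y. \<exists>u\<in>L2 \<tau>. input_map V B \<tau> u = y"
  shows "\<exists>C>0. \<forall>x. norm x \<le> C * L2_norm \<tau> (observation V B \<tau> x)"
proof -
  let ?M = "lebesgue_on {0..\<tau>}" and ?N = "\<lambda>x. L2_norm \<tau> (observation V B \<tau> x)"
  note [simp] = linear_cmul[OF linear_observation]
  have "bounded {x. ?N x \<le> 1}"
  proof (rule weakly_bounded_imp_bounded, rule exI, rule ballI)
    fix y x
    define u where "u = (SOME u. u \<in> L2 \<tau> \<and> input_map V B \<tau> u = y)"
    have u: "u \<in> L2 \<tau>" "input_map V B \<tau> u = y"
      using someI_ex[of "\<lambda>u. u \<in> L2 \<tau> \<and> input_map V B \<tau> u = y"] surj[of y]
      unfolding u_def by blast+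
    let ?F = "observation V B \<tau> x"
    assume "x \<in> {x. ?N x \<le> 1}"
    then have "(?N x)\<^sup>2 \<le> 1" by (simp add: L2_norm_def power_le_one integral_nonneg)
    have int: "integrable ?M (\<lambda>s. u s \<bullet> ?F s)" "(LINT s|?M. u s \<bullet> ?F s) = y \<bullet> x"
      using input_map_inner[OF adm u(1), of x] u(2)
      by (auto simp: has_bochner_integral_iff)
    have sq: "integrable ?M (\<lambda>s. (norm (u s))\<^sup>2)" "integrable ?M (\<lambda>s. (norm (?F s))\<^sup>2)"
      using u(1) observation_in_L2[OF adm sep, of x] by (auto simp: L2_def)
    have "\<bar>y \<bullet> x\<bar> \<le> (LINT s|?M. \<bar>u s \<bullet> ?F s\<bar>)"
      unfolding int(2)[symmetric] by (rule integral_abs_bound)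
    \<comment> \<open>any finite bound suffices, so the inequality \<open>a b \<le> a\<^sup>2 + b\<^sup>2\<close> replaces Cauchy--Schwarz in \<open>L\<^sup>2\<close>\<close>
    also have "\<dots> \<le> (LINT s|?M. (norm (u s))\<^sup>2 + (norm (?F s))\<^sup>2)"
    proof (intro integral_mono Bochner_Integration.integrable_add integrable_abs int sq)
      fix s
      have "\<bar>u s \<bullet> ?F s\<bar> \<le> norm (u s) * norm (?F s)" by (rule Cauchy_Schwarz_ineq2)
      also have "\<dots> \<le> (norm (u s))\<^sup>2 + (norm (?F s))\<^sup>2"
        using sum_squares_bound[of "norm (u s)" "norm (?F s)"]
          mult_nonneg_nonneg[OF norm_ge_zero[of "u s"] norm_ge_zero[of "?F s"]] by linarith
      finally show "\<bar>u s \<bullet> ?F s\<bar> \<le> (norm (u s))\<^sup>2 + (norm (?F s))\<^sup>2" .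
    qed
    also have "\<dots> = (L2_norm \<tau> u)\<^sup>2 + (?N x)\<^sup>2"
      using sq by (simp add: power2_L2_norm)
    also have "\<dots> \<le> (L2_norm \<tau> u)\<^sup>2 + 1" using \<open>(?N x)\<^sup>2 \<le> 1\<close> by simp
    finally show "\<bar>y \<bullet> x\<bar> \<le> (L2_norm \<tau> (SOME u. u \<in> L2 \<tau> \<and> input_map V B \<tau> u = y))\<^sup>2 + 1"
      unfolding u_def .
  qed
  then obtain C where "0 < C" and C: "\<And>x. ?N x \<le> 1 \<Longrightarrow> norm x \<le> C"
    unfolding bounded_pos by auto
  have scale: "?N (c *\<^sub>R x) = \<bar>c\<bar> * ?N x" for c x
    by (simp add: L2_norm_def power_mult_distrib real_sqrt_mult)
  have "norm x \<le> C * ?N x" for x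
  proof (cases "?N x = 0")
    case True
    have "norm x = 0"
    proof (rule ccontr)
      assume "norm x \<noteq> 0"
      \<comment> \<open>all multiples of \<open>x\<close> have observation of norm \<open>0\<close>; this one has norm \<open>2 C\<close>\<close>
      have "norm ((2 * C / norm x) *\<^sub>R x) \<le> C"
        by (rule C) (simp add: scale True del: norm_scaleR)
      then show False using \<open>0 < C\<close> \<open>norm x \<noteq> 0\<close> by simp
    qed
    then show ?thesis using True by simp
  next
    case False
    then have "0 < ?N x" by (simp add: L2_norm_def integral_nonneg less_le)
    have "norm ((1 / ?N x) *\<^sub>R x) \<le> C"
      by (rule C) (use \<open>0 < ?N x\<close> in \<open>simp add: scale\<close>)
    then show ?thesis using \<open>0 < ?N x\<close> by (simp add: field_simps)
  qed
  then show ?thesis using \<open>0 < C\<close> by blast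
qed

text \<open>
  The controllability Gramian \<open>G = \<Psi> \<Psi>\<^sup>*\<close> acts on \<open>H\<close> itself and satisfies \<open>\<langle>G x, x\<rangle> = \<parallel>\<Psi>\<^sup>* x\<parallel>\<^sup>2\<close>, so the
  observability inequality is its coercivity. A solution of \<open>G x = y\<close> yields the control
  \<open>u = \<Psi>\<^sup>* x\<close> with \<open>\<Psi> u = y\<close>.
\<close>

lemma observability_imp_input_map_surj:
  fixes V :: "real \<Rightarrow> real \<Rightarrow> 'h::{real_inner, banach} \<Rightarrow>\<^sub>L 'h"
    and B :: "real \<Rightarrow> 'u::{real_inner, banach} \<Rightarrow>\<^sub>L 'h"
  assumes adm: "admissible \<tau> V B"
    and sep: "\<And>x. ae_separably_valued (lebesgue_on {0..\<tau>}) (observation V B \<tau> x)"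
    and "0 < C" and obs: "\<And>x. norm x \<le> C * L2_norm \<tau> (observation V B \<tau> x)"
  shows "\<exists>u\<in>L2 \<tau>. input_map V B \<tau> u = y"
proof -
  let ?F = "observation V B \<tau>"
  define G where "G x = input_map V B \<tau> (?F x)" for x
  note L2 = observation_in_L2[OF adm sep]
  obtain K0 where K0: "\<And>u. u \<in> L2 \<tau> \<Longrightarrow> norm (input_map V B \<tau> u) \<le> K0 * L2_norm \<tau> u"
    using adm unfolding admissible_def by blast
  define K where "K = max K0 0"
  have N_nonneg: "0 \<le> L2_norm \<tau> (?F x)" for x by (simp add: L2_norm_def integral_nonneg)
  have K: "0 \<le> K" "norm (G x) \<le> K * L2_norm \<tau> (?F x)" for x
    using K0[OF L2[of x]] mult_right_mono[OF _ N_nonneg, of K0 K x] by (auto simp: K_def G_def)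
  have quad: "G x \<bullet> x = (L2_norm \<tau> (?F x))\<^sup>2" for x
    using has_bochner_integral_integral_eq[OF input_map_inner[OF adm L2[of x], of x]]
    by (simp add: power2_L2_norm G_def dot_square_norm)
  have le: "L2_norm \<tau> (?F x) \<le> K * norm x" for x
  proof (cases "L2_norm \<tau> (?F x) = 0")
    case False
    have "L2_norm \<tau> (?F x) * L2_norm \<tau> (?F x) \<le> norm (G x) * norm x"
      using quad[of x] norm_cauchy_schwarz[of "G x" x] by (simp add: power2_eq_square)
    also have "\<dots> \<le> (K * L2_norm \<tau> (?F x)) * norm x"
      by (intro mult_right_mono K norm_ge_zero)
    finally have "L2_norm \<tau> (?F x) * L2_norm \<tau> (?F x) \<le> (K * norm x) * L2_norm \<tau> (?F x)"
      by (simp add: mult_ac)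
    then show ?thesis using False N_nonneg[of x] by (simp add: mult_le_cancel_right)
  qed (simp add: K)
  have "bounded_linear G"
  proof (rule bounded_linear_intro)
    show "G (x + y) = G x + G y" for x y
    proof -
      have "?F (x + y) = (\<lambda>s. ?F x s + ?F y s)"
        by (rule ext) (rule linear_add[OF linear_observation])
      then show ?thesis using adm L2[of x] L2[of y] by (simp add: admissible_def G_def)
    qed
    show "G (c *\<^sub>R x) = c *\<^sub>R G x" for c x
    proof -
      have "?F (c *\<^sub>R x) = (\<lambda>s. c *\<^sub>R ?F x s)"
        by (rule ext) (rule linear_cmul[OF linear_observation])
      then show ?thesis using adm L2[of x] by (simp add: admissible_def G_def)
    qed
    show "norm (G x) \<le> norm x * (K * K)" for x
      using order_trans[OF K(2)[of x] mult_left_mono[OF le[of x] K(1)]] by (simp add: mult_ac)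
  qed
  moreover have "1 / C\<^sup>2 * (norm x)\<^sup>2 \<le> G x \<bullet> x" for x
  proof -
    have "(norm x)\<^sup>2 \<le> (C * L2_norm \<tau> (?F x))\<^sup>2" by (intro power_mono obs norm_ge_zero)
    then show ?thesis using \<open>0 < C\<close> by (simp add: quad power_mult_distrib field_simps)
  qed
  ultimately have "surj G"
    using \<open>0 < C\<close> by (intro coercive_bounded_linear_surj[of G "1 / C\<^sup>2"]) auto
  then obtain x where "G x = y" by (metis surjD)
  then show ?thesis using L2[of x] unfolding G_def by blast
qed

theorem theorem2p1:
  fixes V :: "real \<Rightarrow> real \<Rightarrow> 'h::{real_inner, banach} \<Rightarrow>\<^sub>L 'h"
    and A :: "real \<Rightarrow> 'h \<Rightarrow>\<^sub>L 'h"
    and B :: "real \<Rightarrow> 'u::{real_inner, banach} \<Rightarrow>\<^sub>L 'h"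
    and \<tau> :: real
  assumes "0 < \<tau>"
    and "evolution_family V"
    and "associated_with V A"
    and "admissible \<tau> V B"
    and "\<And>x. ae_separably_valued (lebesgue_on {0..\<tau>})
              (\<lambda>s. adjoint (B s) (adjoint (V \<tau> s) x))"
  shows "exactly_controllable \<tau> V B \<longleftrightarrow>
    (\<exists>C>0. \<forall>x. norm x \<le>
      C * sqrt (LINT s|lebesgue_on {0..\<tau>}. (norm (adjoint (B s) (adjoint (V \<tau> s) x)))\<^sup>2))"
proof -
  have sep: "\<And>x. ae_separably_valued (lebesgue_on {0..\<tau>}) (observation V B \<tau> x)"
    using assms(5) by (simp add: observation_def[abs_def])
  have "exactly_controllable \<tau> V B \<longleftrightarrow>
      (\<exists>C>0. \<forall>x. norm x \<le> C * L2_norm \<tau> (observation V B \<tau> x))"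
    unfolding exactly_controllable_iff_input_map_surj
    using input_map_surj_imp_observability[OF assms(4) sep]
      observability_imp_input_map_surj[OF assms(4) sep] by blast
  then show ?thesis by (simp only: L2_norm_def observation_def)
qed

end
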